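(* For an even integer $d$, let $[d]=V_1\cup V_2$ with $|V_1|=|V_2|=d/2$, let $K_{d/2,d/2}$ be the complete bipartite graph with parts $V_1,V_2$, and let $\mathbb{G}=K_d-G(K_{d/2,d/2},p)$ with $p=3-\sqrt5$ (so $\mathbb{G}$ contains every pair inside $V_1$ or inside $V_2$ as an edge, and each pair $\{i,j\}$ with $i\in V_1$, $j\in V_2$ independently with probability $1-p$). Then the expected value of $\varepsilon(\mathbb{G})$ is a polynomial in $d$ of degree $4$ of the form $$\mathbb{E}[\varepsilon(\mathbb{G})]=\frac{5\sqrt5-11}{8}\,d^4+O(d^3).$$ In particular, for all sufficiently large even $d$, $\mathbb{E}[\varepsilon(\mathbb{G})]>\mathbb{E}[\varepsilon(G(d,1/\sqrt3))]$.
   Context: For a finite simple graph $G$ on $[d]=\{1,\dots,d\}$ and an edge $e=\{i,j\}$, $\rho(e)=\mathbf{e}_i+\mathbf{e}_j\in\mathbb{R}^d$; the edge polytope $\mathcal{P}_G$ is the convex hull of $\{\rho(e): e\in E(G)\}$, and $\varepsilon(G)$ is the number of its 1-dimensional faces. $K_d$ is the complete graph on $[d]$. For $0<p<1$, $G(d,p)$ is the random graph on $[d]$ in which each of the $\binom d2$ pairs is an edge independently with probability $p$; for a graph $H$ on $[d]$, $G(H,p)$ is the random graph on $[d]$ in which each edge of $H$ is chosen independently with probability $p$ and no non-edge of $H$ is chosen. For a (random) graph $H'$ on $[d]$, $K_d-H'$ is the graph on $[d]$ with edge set $E(K_d)\setminus E(H')$. (It is known, by work of Tuan–Ziegler, that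 $\mathbb{E}[\varepsilon(G(d,1/\sqrt3))]=\frac1{54}d^4+O(d^3)$.) *)

theory Defs
  imports
    "HOL-Probability.Probability"
    "HOL-Probability.Product_PMF"
    "HOL-Analysis.Finite_Function_Topology"
    "HOL-Computational_Algebra.Polynomial"
    "HOL-Library.Landau_Symbols"
begin

text \<open>
  A graph on \<open>[d] = {1..d}\<close> is represented by its set of edges, each edge being a two-element
  subset of \<open>{1..d}\<close>.  Since the number \<open>d\<close> varies, \<open>\<real>\<^sup>d\<close> is the space of those finitely supported
  functions \<^typ>\<open>nat \<Rightarrow>\<^sub>0 real\<close> that vanish outside \<open>{1..d}\<close>; the hull of points of this subspace
  and the faces of that hull stay inside it.
\<close>

type_synonym graph = "nat set set"

definition complete_graph :: "nat \<Rightarrow> graph" where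
  "complete_graph d = {e. e \<subseteq> {1..d} \<and> card e = 2}"

definition complete_bipartite :: "nat set \<Rightarrow> nat set \<Rightarrow> graph" where
  "complete_bipartite V1 V2 = {{i, j} | i j. i \<in> V1 \<and> j \<in> V2}"

definition edge_vector :: "nat set \<Rightarrow> (nat \<Rightarrow>\<^sub>0 real)" where
  "edge_vector e = (\<Sum>i\<in>e. Poly_Mapping.single i 1)"

definition edge_polytope :: "graph \<Rightarrow> (nat \<Rightarrow>\<^sub>0 real) set" where
  "edge_polytope G = convex hull (edge_vector ` G)"

text \<open>
  The library's \<^const>\<open>aff_dim\<close> and \<^const>\<open>edge_of\<close> are restricted to the class
  \<^class>\<open>euclidean_space\<close>, to which \<^typ>\<open>nat \<Rightarrow>\<^sub>0 real\<close> does not belong.  The following is the property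
  that defines \<^const>\<open>aff_dim\<close>, stated for arbitrary real vector spaces.
\<close>

definition has_aff_dim :: "'a::real_vector set \<Rightarrow> int \<Rightarrow> bool" where
  "has_aff_dim S n \<longleftrightarrow>
     (\<exists>B. finite B \<and> affine hull B = affine hull S \<and> \<not> affine_dependent B \<and> int (card B) = n + 1)"

definition num_edges_polytope :: "graph \<Rightarrow> nat" (\<open>\<epsilon>\<close>) where
  "\<epsilon> G = card {F. F face_of edge_polytope G \<and> has_aff_dim F 1}"

definition random_subgraph :: "graph \<Rightarrow> real \<Rightarrow> graph pmf" where
  "random_subgraph H p =
     map_pmf (\<lambda>chosen. {e \<in> H. chosen e}) (Pi_pmf H False (\<lambda>_. bernoulli_pmf p))"

definition random_graph :: "nat \<Rightarrow> real \<Rightarrow> graph pmf" where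
  "random_graph d p = random_subgraph (complete_graph d) p"

definition complement_random_bipartite :: "nat \<Rightarrow> nat set \<Rightarrow> nat set \<Rightarrow> real \<Rightarrow> graph pmf" where
  "complement_random_bipartite d V1 V2 p =
     map_pmf (\<lambda>H. complete_graph d - H) (random_subgraph (complete_bipartite V1 V2) p)"

definition expected_num_edges :: "graph pmf \<Rightarrow> real" where
  "expected_num_edges M = measure_pmf.expectation M (\<lambda>G. real (\<epsilon> G))"

definition balanced_bipartition :: "nat \<Rightarrow> nat set \<Rightarrow> nat set \<Rightarrow> bool" where
  "balanced_bipartition d V1 V2 \<longleftrightarrow>
     even d \<and> V1 \<union> V2 = {1..d} \<and> V1 \<inter> V2 = {} \<and> card V1 = d div 2 \<and> card V2 = d div 2"

lemma edge_vector_pair: "i \<noteq> j \<Longrightarrow> edge_vector {i, j} = Poly_Mapping.single i 1 + Poly_Mapping.single j 1"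
  by (simp add: edge_vector_def)

lemma edge_of_iff_has_aff_dim:
  fixes S :: "'a::euclidean_space set"
  shows "F edge_of S \<longleftrightarrow> F face_of S \<and> has_aff_dim F 1"
proof -
  have "aff_dim F = 1 \<longleftrightarrow> has_aff_dim F 1"
  proof
    assume "aff_dim F = 1"
    then show "has_aff_dim F 1"
      using aff_dim_basis_exists[of F] aff_independent_finite unfolding has_aff_dim_def by metis
  next
    assume "has_aff_dim F 1"
    then obtain B where "affine hull B = affine hull F \<and> \<not> affine_dependent B"
      and "int (card B) = 1 + 1" unfolding has_aff_dim_def by blast
    then show "aff_dim F = 1"
      using aff_dim_unique[of B F] by linarith
  qed
  then show ?thesis by (simp add: edge_of_def)
qed

end

theory Submission
  imports Defs "HOL-Real_Asymp.Real_Asymp"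
begin

text \<open>
  Edge vectors are 0/1-vectors, no three of which are collinear, so the 1-dimensional faces of the
  edge polytope are the segments between two edge vectors that happen to be faces.  Two edges with
  a common vertex always span such a face; disjoint edges \<open>ij\<close> and \<open>kl\<close> do so unless \<open>ik, jl\<close> or
  \<open>il, jk\<close> are both edges, because then the segment
  spanned by that other pair crosses it in their common midpoint.  Hence
  the expectation is a sum of products of edge probabilities over triples and quadruples of distinct
  vertices.  In the bipartite model with \<open>q = 1 - p\<close> and \<open>n = d/2\<close>, the quadruples split 3:1 and
  2:2 contribute \<open>n\<^sup>4 (q (1 - q)\<^sup>2 + (1 - q\<^sup>2)\<^sup>2 / 4)\<close> to leading order, and everything else
  is \<open>O(d\<^sup>3)\<close>.
\<close>

section \<open>One-dimensional faces of the edge polytope\<close>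

lemma face_of_convex_hull_Int:
  fixes S :: "'a::real_vector set"
  assumes F: "F face_of convex hull S"
  shows "F = convex hull (F \<inter> S)"
proof
  show "convex hull (F \<inter> S) \<subseteq> F"
    by (rule hull_minimal) (use F face_of_imp_convex in auto)
  \<comment> \<open>\<open>?D\<close> contains \<open>S\<close> and is convex: if a point strictly
    between two of its members lies in \<open>F\<close>, the face property puts both of these in
    \<open>F\<close>, hence in the hull of \<open>F \<inter> S\<close>. So \<open>?D\<close> is all
    of \<open>convex hull S\<close>.\<close>
  let ?D = "{x \<in> convex hull S. x \<in> F \<longrightarrow> x \<in> convex hull (F \<inter> S)}"
  have "convex hull S \<subseteq> ?D"
  proof (rule hull_minimal)
    show "S \<subseteq> ?D"
      by (auto simp: hull_inc)
    have "z \<in> ?D" if x: "x \<in> ?D" and y: "y \<in> ?D" and z: "z \<in> open_segment x y" for x y z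
    proof -
      have "z \<in> convex hull S"
        using x y z convex_convex_hull[of S] unfolding convex_contains_open_segment by blast
      moreover have "z \<in> convex hull (F \<inter> S)" if "z \<in> F"
      proof -
        have "x \<in> F" "y \<in> F"
          using face_ofD[OF F z] x y that by auto
        then show ?thesis
          using x y z convex_convex_hull[of "F \<inter> S"] unfolding convex_contains_open_segment by blast
      qed
      ultimately show ?thesis by blast
    qed
    then show "convex ?D"
      unfolding convex_contains_open_segment by blast
  qed
  then show "F \<subseteq> convex hull (F \<inter> S)"
    using face_of_imp_subset[OF F] by blast
qed

text \<open>The bound by \<open>c\<close> passes from \<open>S\<close> to its hull. If a point
  strictly between two hull points attains \<open>c\<close>, their nonnegative slacks
  \<open>c - \<phi> a\<close> and \<open>c - \<phi> b\<close> have a positive combination equal to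
  zero, so both vanish. The preceding lemma then describes the face by its generators.\<close>

lemma face_of_convex_hull_supporting:
  fixes S :: "'a::real_vector set" and \<phi> :: "'a \<Rightarrow> real"
  assumes lin: "linear \<phi>" and le: "\<And>s. s \<in> S \<Longrightarrow> \<phi> s \<le> c"
  shows "convex hull {s \<in> S. \<phi> s = c} face_of convex hull S"
proof -
  let ?F = "{x \<in> convex hull S. \<phi> x = c}"
  have comb: "\<phi> ((1 - u) *\<^sub>R x + u *\<^sub>R y) = (1 - u) * \<phi> x + u * \<phi> y" for u x y
    by (simp add: linear_add[OF lin] linear_scale[OF lin])
  have "convex {x. \<phi> x \<le> c}"
    unfolding convex_alt by (auto simp: comb intro: convex_bound_le)
  then have le': "\<phi> x \<le> c" if "x \<in> convex hull S" for x
    using hull_minimal[of S "{x. \<phi> x \<le> c}" convex] le that by auto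
  have "convex ?F"
  proof -
    have "convex {x. \<phi> x = c}"
      unfolding convex_alt by (auto simp: comb) (simp add: algebra_simps)
    moreover have "?F = convex hull S \<inter> {x. \<phi> x = c}" by auto
    ultimately show ?thesis by (simp add: convex_Int)
  qed
  moreover have "\<phi> a = c \<and> \<phi> b = c"
    if a: "a \<in> convex hull S" and b: "b \<in> convex hull S" and "x \<in> open_segment a b" "\<phi> x = c" for a b x
  proof -
    obtain u where u: "0 < u" "u < 1" "x = (1 - u) *\<^sub>R a + u *\<^sub>R b"
      using \<open>x \<in> open_segment a b\<close> unfolding in_segment by blast
    then have "(1 - u) * \<phi> a + u * \<phi> b = c"
      using \<open>\<phi> x = c\<close> comb[of u a b] by simp
    then have "(1 - u) * (c - \<phi> a) + u * (c - \<phi> b) = 0"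
      by (simp add: algebra_simps)
    moreover have "(1 - u) * (c - \<phi> a) \<ge> 0" "u * (c - \<phi> b) \<ge> 0"
      using u le' a b by auto
    ultimately have "(1 - u) * (c - \<phi> a) = 0" "u * (c - \<phi> b) = 0" by linarith+
    then show ?thesis using u by auto
  qed
  ultimately have "?F face_of convex hull S"
    unfolding face_of_def by blast
  moreover from face_of_convex_hull_Int[OF this] have "?F = convex hull (?F \<inter> S)" .
  moreover have "?F \<inter> S = {s \<in> S. \<phi> s = c}" by (auto simp: hull_inc)
  ultimately show ?thesis by simp
qed

section \<open>Edge vectors as 0/1-vectors\<close>

lemma lookup_scaleR [simp]:
  fixes x :: "'a \<Rightarrow>\<^sub>0 'b::real_vector"
  shows "Poly_Mapping.lookup (r *\<^sub>R x) i = r *\<^sub>R Poly_Mapping.lookup x i"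
proof -
  have "finite {i. r *\<^sub>R Poly_Mapping.lookup x i \<noteq> 0}"
    by (rule finite_subset[OF _ finite_lookup[of x]]) auto
  then show ?thesis by (simp add: scaleR_poly_mapping_def Abs_poly_mapping_inverse)
qed

lemma lookup_edge_vector:
  assumes "finite e" shows "Poly_Mapping.lookup (edge_vector e) i = of_bool (i \<in> e)"
  using assms by (simp add: edge_vector_def lookup_sum lookup_single when_def sum.delta)

lemma inj_on_edge_vector: "inj_on edge_vector {e. finite e}"
proof (rule inj_onI)
  fix e f assume "e \<in> {e. finite e}" "f \<in> {e. finite e}" "edge_vector e = edge_vector f"
  then have "of_bool (i \<in> e) = (of_bool (i \<in> f) :: real)" for i
    by (metis lookup_edge_vector mem_Collect_eq)
  then have "i \<in> e \<longleftrightarrow> i \<in> f" for i by (metis of_bool_eq_iff)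
  then show "e = f" by blast
qed

text \<open>No three edge vectors are collinear: at a coordinate where \<open>e\<close> and
  \<open>f\<close> differ, the equation reduces to \<open>u\<close> or \<open>v\<close> being 0 or
  1, and since \<open>u + v = 1\<close> one of the two coefficients vanishes.\<close>

lemma edge_vector_in_affine_hull:
  assumes fin: "finite e" "finite f" "finite g" and "e \<noteq> f"
    and g: "edge_vector g \<in> affine hull {edge_vector e, edge_vector f}"
  shows "g = e \<or> g = f"
proof -
  obtain u v where uv: "u + v = 1" "edge_vector g = u *\<^sub>R edge_vector e + v *\<^sub>R edge_vector f"
    using g by (auto simp: affine_hull_2)
  have coord: "of_bool (i \<in> g) = u * of_bool (i \<in> e) + v * of_bool (i \<in> f)" for i
    using arg_cong[OF uv(2), of "\<lambda>x. Poly_Mapping.lookup x i"] fin by (simp add: lookup_edge_vector lookup_add)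
  obtain i where "i \<in> e \<longleftrightarrow> i \<notin> f" using \<open>e \<noteq> f\<close> by blast
  then have "u = 0 \<or> v = 0"
    using coord[of i] uv(1) by (auto simp: of_bool_def split: if_splits)
  then show ?thesis
  proof
    assume "u = 0"
    then have "i \<in> g \<longleftrightarrow> i \<in> f" for i
      using coord[of i] uv(1) by (auto simp: of_bool_def split: if_splits)
    then have "g = f" by blast
    then show ?thesis by simp
  next
    assume "v = 0"
    then have "i \<in> g \<longleftrightarrow> i \<in> e" for i
      using coord[of i] uv(1) by (auto simp: of_bool_def split: if_splits)
    then have "g = e" by blast
    then show ?thesis by simp
  qed
qed

section \<open>One-dimensional faces as pairs of graph edges\<close>

lemma inj_on_convex_hull_edge_pair:
  "inj_on (\<lambda>A. convex hull (edge_vector ` A)) {A. card A = 2 \<and> (\<forall>e\<in>A. finite e)}"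
proof (rule inj_onI)
  have sub: "A \<subseteq> B"
    if A: "A \<in> {A. card A = 2 \<and> (\<forall>e\<in>A. finite e)}" and B: "B \<in> {A. card A = 2 \<and> (\<forall>e\<in>A. finite e)}"
      and eq: "convex hull (edge_vector ` A) = convex hull (edge_vector ` B)" for A B
  proof
    fix g assume g: "g \<in> A"
    obtain e f where ef: "B = {e, f}" "e \<noteq> f" using B by (auto simp: card_2_iff)
    have "edge_vector g \<in> convex hull (edge_vector ` B)"
      using g eq hull_inc[of "edge_vector g" "edge_vector ` A" convex] by auto
    \<comment> \<open>The segment of \<open>B\<close> lies on the line through its two edge vectors,
      and this line contains no third edge vector.\<close>
    then have "edge_vector g \<in> affine hull {edge_vector e, edge_vector f}"
      using convex_hull_subset_affine_hull ef by auto
    then show "g \<in> B"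
      using edge_vector_in_affine_hull[of e f g] A B g ef by auto
  qed
  fix A B assume "A \<in> {A. card A = 2 \<and> (\<forall>e\<in>A. finite e)}" "B \<in> {A. card A = 2 \<and> (\<forall>e\<in>A. finite e)}"
    "convex hull (edge_vector ` A) = convex hull (edge_vector ` B)"
  then show "A = B" by (intro subset_antisym sub; simp)
qed

text \<open>The combinatorial stand-in for the one-dimensional faces. A pair is a two-element set of
  edges rather than a tuple, so that each segment is counted once.\<close>

definition edge_pairs :: "graph \<Rightarrow> nat set set set" where
  "edge_pairs G = {A. A \<subseteq> G \<and> card A = 2 \<and> convex hull (edge_vector ` A) face_of edge_polytope G}"

text \<open>A face is the hull of the edge vectors in it. If it spans a line, two distinct edge
  vectors in it span the same line, and non-collinearity excludes a third. Conversely, two distinct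
  points are affinely independent.\<close>

lemma one_dim_faces_edge_polytope:
  assumes G: "\<And>e. e \<in> G \<Longrightarrow> finite e"
  shows "{F. F face_of edge_polytope G \<and> has_aff_dim F 1} =
           (\<lambda>A. convex hull (edge_vector ` A)) ` edge_pairs G"
proof (intro equalityI subsetI)
  fix F assume "F \<in> {F. F face_of edge_polytope G \<and> has_aff_dim F 1}"
  then have face: "F face_of convex hull (edge_vector ` G)" and dim: "has_aff_dim F 1"
    by (auto simp: edge_polytope_def)
  define A where "A = {e \<in> G. edge_vector e \<in> F}"
  have F: "F = convex hull (edge_vector ` A)"
    using face_of_convex_hull_Int[OF face] by (simp add: A_def Int_def image_def) (smt (verit) Collect_cong mem_Collect_eq)
  obtain B where B: "affine hull B = affine hull F" "card B = 2" "finite B"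
    using dim by (auto simp: has_aff_dim_def)
  have affA: "affine hull B = affine hull (edge_vector ` A)"
    using B F by simp
  have not_small: "\<not> (\<exists>a. edge_vector ` A \<subseteq> {a})"
  proof
    assume "\<exists>a. edge_vector ` A \<subseteq> {a}"
    then obtain a where "edge_vector ` A \<subseteq> {a}" by blast
    then have "affine hull B \<subseteq> {a}"
      unfolding affA by (intro hull_minimal) auto
    then have "B \<subseteq> {a}" using hull_subset[of B affine] by blast
    then show False using B(2) by (auto simp: card_2_iff)
  qed
  then obtain e where e: "e \<in> A" by auto
  with not_small obtain f where f: "f \<in> A" "edge_vector f \<noteq> edge_vector e" by blast
  obtain p q where pq: "B = {p, q}" using B(2) by (auto simp: card_2_iff)
  have line: "affine hull {edge_vector e, edge_vector f} = affine hull (edge_vector ` A)"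
  proof
    show "affine hull {edge_vector e, edge_vector f} \<subseteq> affine hull (edge_vector ` A)"
      by (rule hull_mono) (use e f in auto)
    have "edge_vector e \<in> affine hull {p, q}" "edge_vector f \<in> affine hull {p, q}"
      using affA pq e f by (auto simp: hull_inc)
    then obtain u v where u: "edge_vector e = (1 - u) *\<^sub>R p + u *\<^sub>R q" 
        and v: "edge_vector f = (1 - v) *\<^sub>R p + v *\<^sub>R q"
      unfolding affine_hull_2 by (smt (verit) add_diff_cancel_right' mem_Collect_eq)
    have uv: "u \<noteq> v" using u v f by auto
    \<comment> \<open>Change of parameter on the line: the point with parameter \<open>w\<close>
      with respect to \<open>p\<close>, \<open>q\<close> has parameter
      \<open>(w - u) / (v - u)\<close> with respect to the two edge vectors. The values 0 and 1 of
      \<open>w\<close> recover \<open>p\<close> and \<open>q\<close>.\<close>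
    have lin: "(1 - (w - u) / (v - u)) *\<^sub>R edge_vector e + ((w - u) / (v - u)) *\<^sub>R edge_vector f
        = (1 - w) *\<^sub>R p + w *\<^sub>R q" for w
    proof -
      define t where "t = (w - u) / (v - u)"
      have "(1 - t) *\<^sub>R edge_vector e + t *\<^sub>R edge_vector f
          = (1 - (u + t * (v - u))) *\<^sub>R p + (u + t * (v - u)) *\<^sub>R q"
        unfolding u v by (simp add: algebra_simps)
      moreover have "u + t * (v - u) = w" using uv by (simp add: t_def)
      ultimately show ?thesis by (simp add: t_def)
    qed
    have "p \<in> affine hull {edge_vector e, edge_vector f}"
      unfolding affine_hull_2 using lin[of 0]
      by (intro CollectI exI[of _ "1 - (0 - u) / (v - u)"] exI[of _ "(0 - u) / (v - u)"]) simp
    moreover have "q \<in> affine hull {edge_vector e, edge_vector f}"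
      unfolding affine_hull_2 using lin[of 1]
      by (intro CollectI exI[of _ "1 - (1 - u) / (v - u)"] exI[of _ "(1 - u) / (v - u)"]) simp
    ultimately show "affine hull (edge_vector ` A) \<subseteq> affine hull {edge_vector e, edge_vector f}"
      unfolding affA[symmetric] pq by (intro hull_minimal) (auto simp: affine_affine_hull)
  qed
  have "A \<subseteq> {e, f}"
  proof
    fix g assume g: "g \<in> A"
    then have "edge_vector g \<in> affine hull {edge_vector e, edge_vector f}"
      unfolding line by (auto simp: hull_inc)
    then show "g \<in> {e, f}"
      using edge_vector_in_affine_hull[of e f g] e f g G by (auto simp: A_def)
  qed
  then have "A = {e, f}" "e \<noteq> f" using e f by auto
  then have "card A = 2" by simp
  moreover have "A \<subseteq> G" by (auto simp: A_def)
  ultimately have "A \<in> edge_pairs G"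
    using face F by (simp add: edge_pairs_def edge_polytope_def)
  then show "F \<in> (\<lambda>A. convex hull (edge_vector ` A)) ` edge_pairs G"
    using F by blast
next
  fix F assume "F \<in> (\<lambda>A. convex hull (edge_vector ` A)) ` edge_pairs G"
  then obtain A where A: "A \<in> edge_pairs G" "F = convex hull (edge_vector ` A)" by blast
  have "card (edge_vector ` A) = 2"
    using A G by (subst card_image) (auto simp: edge_pairs_def intro: inj_on_subset[OF inj_on_edge_vector])
  moreover from this obtain a b where ab: "edge_vector ` A = {a, b}" by (auto simp: card_2_iff)
  moreover have "\<not> affine_dependent (edge_vector ` A)"
    using ab by simp
  ultimately have "has_aff_dim F 1"
    unfolding has_aff_dim_def A(2) by (intro exI[of _ "edge_vector ` A"]) auto
  then show "F \<in> {F. F face_of edge_polytope G \<and> has_aff_dim F 1}"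
    using A by (auto simp: edge_pairs_def)
qed

lemma num_edges_polytope_eq_card_edge_pairs:
  assumes "\<And>e. e \<in> G \<Longrightarrow> finite e"
  shows "\<epsilon> G = card (edge_pairs G)"
proof -
  have "inj_on (\<lambda>A. convex hull (edge_vector ` A)) (edge_pairs G)"
    by (rule inj_on_subset[OF inj_on_convex_hull_edge_pair])
       (use assms in \<open>auto simp: edge_pairs_def\<close>)
  moreover have "{F. F face_of edge_polytope G \<and> has_aff_dim F 1} =
      (\<lambda>A. convex hull (edge_vector ` A)) ` edge_pairs G"
    using assms by (rule one_dim_faces_edge_polytope)
  ultimately show ?thesis
    unfolding num_edges_polytope_def by (simp add: card_image)
qed

text \<open>The vertex weighting \<open>w\<close> acts as a supporting linear functional.\<close>
lemma edge_pairsI_weight: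
  fixes w :: "nat \<Rightarrow> real"
  assumes V: "finite V" "\<And>e. e \<in> G \<Longrightarrow> e \<subseteq> V"
    and A: "A \<subseteq> G" "card A = 2" "\<And>e. e \<in> A \<Longrightarrow> sum w e = c"
    and less: "\<And>e. e \<in> G - A \<Longrightarrow> sum w e < c"
  shows "A \<in> edge_pairs G"
proof -
  define \<phi> where "\<phi> = (\<lambda>x :: nat \<Rightarrow>\<^sub>0 real. \<Sum>v\<in>V. w v * Poly_Mapping.lookup x v)"
  have lin: "linear \<phi>"
    by (rule linearI) (simp_all add: \<phi>_def lookup_add algebra_simps sum.distrib sum_distrib_left)
  have val: "\<phi> (edge_vector e) = sum w e" if "e \<in> G" for e
  proof -
    have "finite e" "V \<inter> e = e" using V(2)[OF that] finite_subset[OF _ V(1)] by auto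
    then show ?thesis
      unfolding \<phi>_def using V(1) by (simp add: lookup_edge_vector of_bool_def if_distrib sum.If_cases cong: if_cong)
  qed
  have "sum w e = c \<longleftrightarrow> e \<in> A" if "e \<in> G" for e
    using A(3)[of e] less[of e] that by fastforce
  then have "{s \<in> edge_vector ` G. \<phi> s = c} = edge_vector ` A"
    using A(1) val by (fastforce simp: image_iff)
  moreover have "sum w e \<le> c" if "e \<in> G" for e
    using A(3)[of e] less[of e] that by fastforce
  then have "\<phi> s \<le> c" if "s \<in> edge_vector ` G" for s
    using that val by auto
  ultimately show ?thesis
    using face_of_convex_hull_supporting[OF lin, of "edge_vector ` G" c] A
    by (simp add: edge_pairs_def edge_polytope_def)
qed

section \<open>Combinatorial criterion for a pair of edges to span a face\<close>

lemma complete_graphE: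
  assumes "G \<subseteq> complete_graph d" "e \<in> G"
  obtains a b where "e = {a, b}" "a \<noteq> b" "a \<in> {1..d}" "b \<in> {1..d}"
  using assms by (force simp: complete_graph_def card_2_iff)

lemma edge_pairs_adjacent:
  assumes G: "G \<subseteq> complete_graph d" and A: "{i, j} \<in> G" "{i, k} \<in> G" and "j \<noteq> k"
  shows "{{i, j}, {i, k}} \<in> edge_pairs G"
proof -
  \<comment> \<open>Both given edges weigh 3. Any other edge at \<open>i\<close> weighs 2, and an
    edge avoiding \<open>i\<close> weighs at most 2, with equality only for
    \<open>{j, k}\<close>.\<close>
  let ?w = "\<lambda>v. if v = i then 2 else if v = j \<or> v = k then 1 else 0 :: real"
  have "card {i, j} = 2" "card {i, k} = 2"
    using G A by (auto simp: complete_graph_def)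
  then have ij: "i \<noteq> j" "i \<noteq> k" by auto
  show ?thesis
  proof (rule edge_pairsI_weight[where w = ?w and c = 3 and V = "{1..d}"])
    show "e \<subseteq> {1..d}" if "e \<in> G" for e
      using that G by (auto simp: complete_graph_def)
    show "card {{i, j}, {i, k}} = 2"
      using \<open>j \<noteq> k\<close> by (simp add: doubleton_eq_iff)
    show "sum ?w e = 3" if "e \<in> {{i, j}, {i, k}}" for e
      using that ij \<open>j \<noteq> k\<close> by auto
    show "sum ?w e < 3" if e: "e \<in> G - {{i, j}, {i, k}}" for e
    proof -
      obtain a b where "e = {a, b}" "a \<noteq> b"
        using complete_graphE[OF G] e by blast
      then show ?thesis using e by (auto simp: insert_commute)
    qed
  qed (use A in auto)
qed

lemma edge_pairs_disjointI:
  assumes G: "G \<subseteq> complete_graph d" and A: "{i, j} \<in> G" "{k, l} \<in> G"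
    and dist: "distinct [i, j, k, l]" and miss: "{i, k} \<notin> G" "{i, l} \<notin> G"
  shows "{{i, j}, {k, l}} \<in> edge_pairs G"
proof -
  \<comment> \<open>Both given edges weigh 1. Of the other pairs among the four vertices only
    \<open>{i, k}\<close> and \<open>{i, l}\<close> weigh more than 1, and these are missing from
    \<open>G\<close>; the value -10 pushes every edge leaving the four vertices below 1.\<close>
  let ?w = "\<lambda>v. if v = i then 2 else if v = j then -1 else if v = k \<or> v = l then 1 / 2 else -10 :: real"
  show ?thesis
  proof (rule edge_pairsI_weight[where w = ?w and c = 1 and V = "{1..d}"])
    show "e \<subseteq> {1..d}" if "e \<in> G" for e
      using that G by (auto simp: complete_graph_def)
    show "card {{i, j}, {k, l}} = 2"
      using dist by (simp add: doubleton_eq_iff)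
    show "sum ?w e = 1" if "e \<in> {{i, j}, {k, l}}" for e
      using that dist by auto
    show "sum ?w e < 1" if e: "e \<in> G - {{i, j}, {k, l}}" for e
    proof -
      obtain a b where "e = {a, b}" "a \<noteq> b"
        using complete_graphE[OF G] e by blast
      then show ?thesis using e miss by (auto simp: insert_commute)
    qed
  qed (use A in auto)
qed

text \<open>The segments of the two matchings \<open>{i, j}\<close>, \<open>{k, l}\<close> and
  \<open>{i, k}\<close>, \<open>{j, l}\<close> share their midpoint. A face containing it would
  contain the edge vector of \<open>{i, k}\<close>, which would then be collinear with those of
  \<open>{i, j}\<close> and \<open>{k, l}\<close>.\<close>

lemma edge_pairs_disjointD:
  assumes A: "{{i, j}, {k, l}} \<in> edge_pairs G" and dist: "distinct [i, j, k, l]"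
    and G: "{i, k} \<in> G" "{j, l} \<in> G"
  shows False
proof -
  let ?\<rho> = edge_vector
  let ?F = "convex hull {?\<rho> {i, j}, ?\<rho> {k, l}}"
  have F: "?F face_of convex hull (?\<rho> ` G)"
    using A by (simp add: edge_pairs_def edge_polytope_def)
  let ?m = "(1/2) *\<^sub>R ?\<rho> {i, j} + (1/2) *\<^sub>R ?\<rho> {k, l}"
  have "?\<rho> {i, j} + ?\<rho> {k, l} = ?\<rho> {i, k} + ?\<rho> {j, l}"
    using dist by (simp add: edge_vector_pair algebra_simps)
  then have m: "?m = (1/2) *\<^sub>R ?\<rho> {i, k} + (1/2) *\<^sub>R ?\<rho> {j, l}"
    by (metis scaleR_add_right)
  have "?\<rho> {i, k} \<noteq> ?\<rho> {j, l}"
    using dist inj_onD[OF inj_on_edge_vector, of "{i, k}" "{j, l}"] by (auto simp: doubleton_eq_iff)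
  then have "?m \<in> open_segment (?\<rho> {i, k}) (?\<rho> {j, l})"
    unfolding m in_segment by (intro conjI exI[of _ "1/2"]) auto
  moreover have "?m \<in> ?F"
    unfolding segment_convex_hull[symmetric] in_segment by (intro exI[of _ "1/2"]) auto
  ultimately have "?\<rho> {i, k} \<in> ?F"
    using face_ofD[OF F] G by (simp add: hull_inc)
  then have "?\<rho> {i, k} \<in> affine hull {?\<rho> {i, j}, ?\<rho> {k, l}}"
    using convex_hull_subset_affine_hull by blast
  then have "{i, k} = {i, j} \<or> {i, k} = {k, l}"
    using dist by (intro edge_vector_in_affine_hull) (auto simp: doubleton_eq_iff)
  then show False using dist by (auto simp: doubleton_eq_iff)
qed

lemma edge_pairs_disjoint_iff:
  assumes G: "G \<subseteq> complete_graph d" and dist: "distinct [i, j, k, l]"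
  shows "{{i, j}, {k, l}} \<in> edge_pairs G \<longleftrightarrow> {i, j} \<in> G \<and> {k, l} \<in> G \<and>
           \<not> ({i, k} \<in> G \<and> {j, l} \<in> G) \<and> \<not> ({i, l} \<in> G \<and> {j, k} \<in> G)"
    (is "?L \<longleftrightarrow> ?R")
proof
  assume L: ?L
  then have "{i, j} \<in> G" "{k, l} \<in> G" by (auto simp: edge_pairs_def)
  moreover have "{{i, j}, {l, k}} \<in> edge_pairs G" using L by (simp add: insert_commute)
  ultimately show ?R
    using edge_pairs_disjointD[OF L dist] edge_pairs_disjointD[of i j l k G] dist by auto
next
  assume R: ?R
  \<comment> \<open>Each of the two crossing matchings misses an edge. Two such edges, one from each
    matching, always meet in a vertex, and this vertex takes the place of \<open>i\<close> in
    \<open>edge_pairs_disjointI\<close>.\<close>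
  then consider "{i, k} \<notin> G" "{i, l} \<notin> G" | "{i, k} \<notin> G" "{j, k} \<notin> G"
    | "{j, l} \<notin> G" "{i, l} \<notin> G" | "{j, l} \<notin> G" "{j, k} \<notin> G" by blast
  then show ?L
  proof cases
    case 1 then show ?thesis using edge_pairs_disjointI[OF G, of i j k l] R dist by auto
  next
    case 2 then show ?thesis
      using edge_pairs_disjointI[OF G, of k l i j] R dist by (auto simp: insert_commute)
  next
    case 3 then show ?thesis
      using edge_pairs_disjointI[OF G, of l k i j] R dist by (auto simp: insert_commute)
  next
    case 4 then show ?thesis
      using edge_pairs_disjointI[OF G, of j i k l] R dist by (auto simp: insert_commute)
  qed
qed

section \<open>Expectation for independent edges\<close>

lemma sum_pairs_insert:
  fixes g :: "'a set \<Rightarrow> 'b::comm_monoid_add"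
  assumes V: "finite V" "x \<notin> V"
  shows "(\<Sum>A | A \<subseteq> insert x V \<and> card A = 2. g A) = (\<Sum>A | A \<subseteq> V \<and> card A = 2. g A) + (\<Sum>y\<in>V. g {x, y})"
proof -
  let ?P = "{A. A \<subseteq> V \<and> card A = 2}"
  have "{A. A \<subseteq> insert x V \<and> card A = 2} = ?P \<union> (\<lambda>y. {x, y}) ` V"
  proof (intro equalityI subsetI)
    fix A assume A: "A \<in> {A. A \<subseteq> insert x V \<and> card A = 2}"
    then obtain a b where "A = {a, b}" "a \<noteq> b" by (auto simp: card_2_iff)
    with A V show "A \<in> ?P \<union> (\<lambda>y. {x, y}) ` V" by (auto simp: insert_commute)
  qed (use V in \<open>auto simp: card_insert_if\<close>)
  moreover have "?P \<inter> (\<lambda>y. {x, y}) ` V = {}" using V by auto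
  moreover have "finite ?P" using V by simp
  moreover have "inj_on (\<lambda>y. {x, y}) V" by (auto simp: inj_on_def doubleton_eq_iff)
  ultimately show ?thesis
    using V by (simp add: sum.union_disjoint sum.reindex)
qed

lemma sum_pairs:
  fixes g :: "'a set \<Rightarrow> real"
  assumes "finite V"
  shows "(\<Sum>A | A \<subseteq> V \<and> card A = 2. g A) = (\<Sum>x\<in>V. \<Sum>y\<in>V - {x}. g {x, y}) / 2"
  using assms
proof (induction V rule: finite_induct)
  case empty
  then show ?case by (auto intro!: sum.neutral)
next
  case (insert x V)
  have "(\<Sum>y\<in>insert x V - {z}. g {z, y}) = (\<Sum>y\<in>V - {z}. g {z, y}) + g {x, z}" if "z \<in> V" for z
  proof -
    have "insert x V - {z} = insert x (V - {z})" using insert that by auto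
    then show ?thesis using insert by (simp add: insert_commute)
  qed
  moreover have "insert x V - {x} = V" using insert by auto
  ultimately have "(\<Sum>z\<in>insert x V. \<Sum>y\<in>insert x V - {z}. g {z, y}) =
      (\<Sum>y\<in>V. g {x, y}) + ((\<Sum>z\<in>V. \<Sum>y\<in>V - {z}. g {z, y}) + (\<Sum>z\<in>V. g {x, z}))"
    using insert by (simp add: sum.distrib)
  then show ?case
    using insert by (simp add: sum_pairs_insert)
qed

text \<open>The 4 accounts for ordering the two edges and ordering the ends \<open>i\<close>,
  \<open>j\<close> of the first. The 2 accounts for ordering \<open>k\<close>, \<open>l\<close> when
  the edges are disjoint; an adjacent second edge is determined by the shared end and
  \<open>k\<close>.\<close>

lemma sum_pairs_of_pairs:
  fixes g :: "'a set set \<Rightarrow> real"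
  assumes V: "finite V"
  defines "K \<equiv> {e. e \<subseteq> V \<and> card e = 2}"
  shows "(\<Sum>A | A \<subseteq> K \<and> card A = 2. g A) =
    (\<Sum>i\<in>V. \<Sum>j\<in>V - {i}. (\<Sum>k\<in>V - {i, j}. \<Sum>l\<in>V - {i, j, k}. g {{i, j}, {k, l}}) / 2
       + (\<Sum>k\<in>V - {i, j}. g {{i, j}, {i, k}} + g {{i, j}, {j, k}})) / 4"
proof -
  have K: "finite K" using V by (simp add: K_def)
  have inner: "(\<Sum>f\<in>K - {{i, j}}. g {{i, j}, f}) =
      (\<Sum>k\<in>V - {i, j}. \<Sum>l\<in>V - {i, j, k}. g {{i, j}, {k, l}}) / 2
       + (\<Sum>k\<in>V - {i, j}. g {{i, j}, {i, k}} + g {{i, j}, {j, k}})"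
    if ij: "i \<in> V" "j \<in> V - {i}" for i j
  proof -
    \<comment> \<open>Splitting off \<open>i\<close> and then \<open>j\<close> from \<open>V\<close>
      sorts the second edge by how it meets \<open>{i, j}\<close>. The case where it equals
      \<open>{i, j}\<close> also appears and cancels against the subtracted term.\<close>
    define W where "W = V - {i, j}"
    have W: "V = insert i (insert j W)" "finite W" "j \<notin> W" "i \<notin> insert j W"
      using V ij by (auto simp: W_def)
    have "{i, j} \<in> K" using ij by (auto simp: K_def)
    then have "(\<Sum>f\<in>K - {{i, j}}. g {{i, j}, f}) = (\<Sum>f\<in>K. g {{i, j}, f}) - g {{i, j}, {i, j}}"
      using K by (simp add: sum_diff1)
    also have "(\<Sum>f\<in>K. g {{i, j}, f}) = (\<Sum>f | f \<subseteq> W \<and> card f = 2. g {{i, j}, f})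
        + (\<Sum>k\<in>W. g {{i, j}, {j, k}}) + (g {{i, j}, {i, j}} + (\<Sum>k\<in>W. g {{i, j}, {i, k}}))"
      unfolding K_def W(1) using W by (simp add: sum_pairs_insert)
    also have "(\<Sum>f | f \<subseteq> W \<and> card f = 2. g {{i, j}, f}) =
        (\<Sum>k\<in>W. \<Sum>l\<in>W - {k}. g {{i, j}, {k, l}}) / 2"
      using W(2) by (rule sum_pairs)
    also have "(\<Sum>k\<in>W. \<Sum>l\<in>W - {k}. g {{i, j}, {k, l}}) =
        (\<Sum>k\<in>V - {i, j}. \<Sum>l\<in>V - {i, j, k}. g {{i, j}, {k, l}})"
      by (auto simp: W_def intro!: sum.cong)
    finally show ?thesis
      by (simp add: W_def[symmetric] sum.distrib)
  qed
  have "(\<Sum>A | A \<subseteq> K \<and> card A = 2. g A) = (\<Sum>e\<in>K. \<Sum>f\<in>K - {e}. g {e, f}) / 2"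
    using K by (rule sum_pairs)
  also have "(\<Sum>e\<in>K. \<Sum>f\<in>K - {e}. g {e, f}) =
      (\<Sum>i\<in>V. \<Sum>j\<in>V - {i}. \<Sum>f\<in>K - {{i, j}}. g {{i, j}, f}) / 2"
    unfolding K_def by (rule sum_pairs[OF V])
  also have "(\<Sum>i\<in>V. \<Sum>j\<in>V - {i}. \<Sum>f\<in>K - {{i, j}}. g {{i, j}, f}) =
      (\<Sum>i\<in>V. \<Sum>j\<in>V - {i}. (\<Sum>k\<in>V - {i, j}. \<Sum>l\<in>V - {i, j, k}. g {{i, j}, {k, l}}) / 2
       + (\<Sum>k\<in>V - {i, j}. g {{i, j}, {i, k}} + g {{i, j}, {j, k}}))"
    by (intro sum.cong refl inner)
  finally show ?thesis by simp
qed

section \<open>Expectation from inclusion probabilities\<close>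

text \<open>Inclusion probabilities suffice, since every event needed is a combination of them by
  inclusion-exclusion.\<close>
definition independent_edges :: "nat \<Rightarrow> graph pmf \<Rightarrow> (nat set \<Rightarrow> real) \<Rightarrow> bool" where
  "independent_edges d M pr \<longleftrightarrow> set_pmf M \<subseteq> Pow (complete_graph d) \<and>
     (\<forall>A \<subseteq> complete_graph d. measure_pmf.prob M {G. A \<subseteq> G} = (\<Prod>e\<in>A. pr e))"

lemma finite_complete_graph [simp]: "finite (complete_graph d)"
  unfolding complete_graph_def by simp

lemma pair_in_complete_graph [simp]:
  "{i, j} \<in> complete_graph d \<longleftrightarrow> i \<in> {1..d} \<and> j \<in> {1..d} \<and> i \<noteq> j"
  by (auto simp: complete_graph_def card_insert_if)

text \<open>Writing the probability as a finite weighted sum lets identities between indicators be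
  summed term by term.\<close>

lemma independent_edges_prob_subset:
  assumes "independent_edges d M pr" "A \<subseteq> complete_graph d"
  shows "(\<Sum>G\<in>Pow (complete_graph d). of_bool (A \<subseteq> G) * pmf M G) = (\<Prod>e\<in>A. pr e)"
proof -
  have "(\<Prod>e\<in>A. pr e) = measure_pmf.expectation M (indicator {G. A \<subseteq> G})"
    using assms by (simp add: independent_edges_def)
  also have "\<dots> = (\<Sum>G\<in>Pow (complete_graph d). indicator {G. A \<subseteq> G} G * pmf M G)"
    by (rule integral_measure_pmf_real) (use assms in \<open>auto simp: independent_edges_def\<close>)
  finally show ?thesis by (simp add: indicator_def)
qed

lemma expected_num_edges_independent:
  assumes M: "independent_edges d M pr"
  shows "expected_num_edges M =
    (\<Sum>i\<in>{1..d}. \<Sum>j\<in>{1..d} - {i}.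
       (\<Sum>k\<in>{1..d} - {i, j}. \<Sum>l\<in>{1..d} - {i, j, k}.
          pr {i, j} * pr {k, l} * (1 - pr {i, k} * pr {j, l}) * (1 - pr {i, l} * pr {j, k})) / 2
       + (\<Sum>k\<in>{1..d} - {i, j}. pr {i, j} * pr {i, k} + pr {i, j} * pr {j, k})) / 4"
proof -
  let ?K = "complete_graph d"
  \<comment> \<open>\<open>q A\<close> is the probability that \<open>A\<close> spans a face; the
    expectation is the sum of these by linearity.\<close>
  define q where "q = (\<lambda>A. \<Sum>G\<in>Pow ?K. of_bool (A \<in> edge_pairs G) * pmf M G)"
  have num: "real (\<epsilon> G) = (\<Sum>A | A \<subseteq> ?K \<and> card A = 2. of_bool (A \<in> edge_pairs G))" if "G \<subseteq> ?K" for G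
  proof -
    have "finite e" if "e \<in> G" for e
      using complete_graphE[OF \<open>G \<subseteq> ?K\<close> that] by (metis finite.emptyI finite.insertI)
    then have "\<epsilon> G = card (edge_pairs G)" by (rule num_edges_polytope_eq_card_edge_pairs)
    moreover have "edge_pairs G = {A. A \<subseteq> ?K \<and> card A = 2} \<inter> {A. A \<in> edge_pairs G}"
      using that by (auto simp: edge_pairs_def)
    ultimately show ?thesis by (simp add: of_bool_def sum.If_cases)
  qed
  have "expected_num_edges M = (\<Sum>G\<in>Pow ?K. real (\<epsilon> G) * pmf M G)"
    unfolding expected_num_edges_def
    by (rule integral_measure_pmf_real) (use M in \<open>auto simp: independent_edges_def\<close>)
  also have "\<dots> = (\<Sum>G\<in>Pow ?K. \<Sum>A | A \<subseteq> ?K \<and> card A = 2. of_bool (A \<in> edge_pairs G) * pmf M G)"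
    by (rule sum.cong) (auto simp: num sum_distrib_right)
  also have "\<dots> = (\<Sum>A | A \<subseteq> ?K \<and> card A = 2. q A)"
    unfolding q_def by (rule sum.swap)
  also have "\<dots> = (\<Sum>i\<in>{1..d}. \<Sum>j\<in>{1..d} - {i}.
       (\<Sum>k\<in>{1..d} - {i, j}. \<Sum>l\<in>{1..d} - {i, j, k}. q {{i, j}, {k, l}}) / 2
       + (\<Sum>k\<in>{1..d} - {i, j}. q {{i, j}, {i, k}} + q {{i, j}, {j, k}})) / 4"
    unfolding complete_graph_def by (rule sum_pairs_of_pairs) simp
  finally have E: "expected_num_edges M = (\<Sum>i\<in>{1..d}. \<Sum>j\<in>{1..d} - {i}.
       (\<Sum>k\<in>{1..d} - {i, j}. \<Sum>l\<in>{1..d} - {i, j, k}. q {{i, j}, {k, l}}) / 2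
       + (\<Sum>k\<in>{1..d} - {i, j}. q {{i, j}, {i, k}} + q {{i, j}, {j, k}})) / 4" .
  have adjacent: "q {{i, j}, {i, k}} = pr {i, j} * pr {i, k}"
    if "i \<in> {1..d}" "j \<in> {1..d}" "k \<in> {1..d}" "distinct [i, j, k]" for i j k
  proof -
    have "of_bool ({{i, j}, {i, k}} \<in> edge_pairs G) = (of_bool ({{i, j}, {i, k}} \<subseteq> G) :: real)"
      if "G \<subseteq> ?K" for G
      using edge_pairs_adjacent[OF that, of i j k] \<open>distinct [i, j, k]\<close> by (auto simp: edge_pairs_def)
    then have "q {{i, j}, {i, k}} = (\<Sum>G\<in>Pow ?K. of_bool ({{i, j}, {i, k}} \<subseteq> G) * pmf M G)"
      unfolding q_def by (intro sum.cong) auto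
    also have "\<dots> = (\<Prod>e\<in>{{i, j}, {i, k}}. pr e)"
      by (rule independent_edges_prob_subset[OF M]) (use that in auto)
    finally show ?thesis
      using that by (simp add: doubleton_eq_iff)
  qed
  have disjoint: "q {{i, j}, {k, l}} =
      pr {i, j} * pr {k, l} * (1 - pr {i, k} * pr {j, l}) * (1 - pr {i, l} * pr {j, k})"
    if V: "i \<in> {1..d}" "j \<in> {1..d}" "k \<in> {1..d}" "l \<in> {1..d}" and dist: "distinct [i, j, k, l]" for i j k l
  proof -
    let ?B = "{{i, j}, {k, l}}" and ?C = "{{i, k}, {j, l}}" and ?D = "{{i, l}, {j, k}}"
    let ?p = "\<lambda>A. \<Sum>G\<in>Pow ?K. of_bool (A \<subseteq> G) * pmf M G"
    \<comment> \<open>Inclusion-exclusion over the events that \<open>?C\<close> or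
      \<open>?D\<close> is contained in \<open>G\<close>. The sets \<open>?B\<close>,
      \<open>?C\<close>, \<open>?D\<close> are the three perfect matchings of the four vertices,
      hence disjoint, so the resulting products recombine into the factored form.\<close>
    have "of_bool (?B \<in> edge_pairs G) = (of_bool (?B \<subseteq> G) - of_bool (?B \<union> ?C \<subseteq> G)
        - of_bool (?B \<union> ?D \<subseteq> G) + of_bool (?B \<union> ?C \<union> ?D \<subseteq> G) :: real)" if "G \<subseteq> ?K" for G
      unfolding edge_pairs_disjoint_iff[OF that dist] by auto
    then have "q ?B = (\<Sum>G\<in>Pow ?K. (of_bool (?B \<subseteq> G) - of_bool (?B \<union> ?C \<subseteq> G)
        - of_bool (?B \<union> ?D \<subseteq> G) + of_bool (?B \<union> ?C \<union> ?D \<subseteq> G)) * pmf M G)"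
      unfolding q_def by (intro sum.cong) auto
    also have "\<dots> = ?p ?B - ?p (?B \<union> ?C) - ?p (?B \<union> ?D) + ?p (?B \<union> ?C \<union> ?D)"
      by (simp only: distrib_right left_diff_distrib sum.distrib sum_subtractf)
    also have "?p ?B = (\<Prod>e\<in>?B. pr e)"
      by (rule independent_edges_prob_subset[OF M]) (use V dist in auto)
    also have "?p (?B \<union> ?C) = (\<Prod>e\<in>?B \<union> ?C. pr e)"
      by (rule independent_edges_prob_subset[OF M]) (use V dist in auto)
    also have "?p (?B \<union> ?D) = (\<Prod>e\<in>?B \<union> ?D. pr e)"
      by (rule independent_edges_prob_subset[OF M]) (use V dist in auto)
    also have "?p (?B \<union> ?C \<union> ?D) = (\<Prod>e\<in>?B \<union> ?C \<union> ?D. pr e)"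
      by (rule independent_edges_prob_subset[OF M]) (use V dist in auto)
    finally show ?thesis
      using dist by (simp add: doubleton_eq_iff) (simp add: algebra_simps)
  qed
  have adjacent': "q {{i, j}, {j, k}} = pr {i, j} * pr {j, k}"
    if "i \<in> {1..d}" "j \<in> {1..d}" "k \<in> {1..d}" "distinct [i, j, k]" for i j k
    using adjacent[of j i k] that by (simp add: insert_commute)
  show ?thesis
    unfolding E
    by (intro arg_cong2[where f = "(/)"] arg_cong2[where f = "(+)"] sum.cong refl;
        rule adjacent adjacent' disjoint; auto)
qed

section \<open>The two random graph models\<close>

lemma prob_Pi_bernoulli_const:
  assumes H: "finite H" and p: "0 \<le> p" "p \<le> 1"
  shows "measure_pmf.prob (Pi_pmf H False (\<lambda>_. bernoulli_pmf p)) {f. \<forall>e\<in>A \<inter> H. f e = b} =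
           (\<Prod>e\<in>A \<inter> H. if b then p else 1 - p)"
proof -
  \<comment> \<open>The event is a box, unconstrained outside \<open>A\<close>. The value
    \<open>b\<close> is True when chosen edges are kept and False when they are deleted.\<close>
  have "{f. \<forall>e\<in>A \<inter> H. f e = b} = Pi H (\<lambda>e. if e \<in> A then {b} else UNIV)"
    by (auto simp: Pi_def split: if_splits)
  then have "measure_pmf.prob (Pi_pmf H False (\<lambda>_. bernoulli_pmf p)) {f. \<forall>e\<in>A \<inter> H. f e = b} =
      (\<Prod>e\<in>H. measure_pmf.prob (bernoulli_pmf p) (if e \<in> A then {b} else UNIV))"
    using H by (simp add: measure_Pi_pmf_Pi)
  also have "\<dots> = (\<Prod>e\<in>H. if e \<in> A then (if b then p else 1 - p) else 1)"
    using p by (intro prod.cong) (auto simp: measure_pmf_single)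
  also have "\<dots> = (\<Prod>e\<in>A \<inter> H. if b then p else 1 - p)"
    using H by (subst prod.inter_restrict[symmetric]) (auto simp: Int_commute)
  finally show ?thesis .
qed

lemma independent_edges_random_graph:
  assumes p: "0 \<le> p" "p \<le> 1"
  shows "independent_edges d (random_graph d p) (\<lambda>_. p)"
  unfolding independent_edges_def
proof (intro conjI allI impI)
  let ?K = "complete_graph d"
  show "set_pmf (random_graph d p) \<subseteq> Pow ?K"
    by (auto simp: random_graph_def random_subgraph_def)
  fix A assume A: "A \<subseteq> ?K"
  then have "(\<lambda>f. {e \<in> ?K. f e}) -` {G. A \<subseteq> G} = {f. \<forall>e\<in>A \<inter> ?K. f e = True}"
    by auto
  then show "measure_pmf.prob (random_graph d p) {G. A \<subseteq> G} = (\<Prod>e\<in>A. p)"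
    using A prob_Pi_bernoulli_const[OF _ p, of ?K A True]
    by (simp add: random_graph_def random_subgraph_def Int_absorb2)
qed

text \<open>Edges inside a part are always present, so \<open>A\<close> is contained in the graph
  exactly when no edge of \<open>A\<close> in the bipartite graph was chosen for deletion.\<close>

lemma independent_edges_complement_random_bipartite:
  assumes p: "0 \<le> p" "p \<le> 1" and V: "V1 \<union> V2 = {1..d}"
  shows "independent_edges d (complement_random_bipartite d V1 V2 p)
           (\<lambda>e. if e \<in> complete_bipartite V1 V2 then 1 - p else 1)"
  unfolding independent_edges_def
proof (intro conjI allI impI)
  let ?K = "complete_graph d" and ?H = "complete_bipartite V1 V2"
  show "set_pmf (complement_random_bipartite d V1 V2 p) \<subseteq> Pow ?K"
    by (auto simp: complement_random_bipartite_def)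
  have H: "finite ?H"
    by (rule finite_subset[of _ "Pow {1..d}"]) (use V in \<open>auto simp: complete_bipartite_def\<close>)
  fix A assume A: "A \<subseteq> ?K"
  then have "(\<lambda>f. ?K - {e \<in> ?H. f e}) -` {G. A \<subseteq> G} = {f. \<forall>e\<in>A \<inter> ?H. f e = False}"
    by auto
  then have "measure_pmf.prob (complement_random_bipartite d V1 V2 p) {G. A \<subseteq> G} = (\<Prod>e\<in>A \<inter> ?H. 1 - p)"
    using prob_Pi_bernoulli_const[OF H p, of A False]
    by (simp add: complement_random_bipartite_def random_subgraph_def map_pmf_comp)
  also have "\<dots> = (\<Prod>e\<in>A. if e \<in> ?H then 1 - p else 1)"
    using finite_subset[OF A] by (subst prod.inter_restrict) auto
  finally show "measure_pmf.prob (complement_random_bipartite d V1 V2 p) {G. A \<subseteq> G} = \<dots>" .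
qed

section \<open>Exact expectations by counting coloured vertices\<close>

text \<open>When the summand depends only on the colours \<open>c\<close> of the vertices, each inner sum over the
  remaining vertices is the unrestricted sum \<open>S\<close> minus the terms of the vertices already used.\<close>
lemma sum_distinct_coloured:
  fixes S :: "('c \<Rightarrow> real) \<Rightarrow> real" and c :: "'a \<Rightarrow> 'c"
  assumes V: "finite V" and S: "\<And>U. (\<Sum>v\<in>V. U (c v)) = S U"
  shows "(\<Sum>i\<in>V. \<Sum>j\<in>V - {i}. (\<Sum>k\<in>V - {i, j}. \<Sum>l\<in>V - {i, j, k}. T (c i) (c j) (c k) (c l)) / 2
            + (\<Sum>k\<in>V - {i, j}. R (c i) (c j) (c k))) =
    (let F3 = (\<lambda>w x y. S (T w x y) - T w x y w - T w x y x - T w x y y);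
         F2 = (\<lambda>w x. (S (F3 w x) - F3 w x w - F3 w x x) / 2 + (S (R w x) - R w x w - R w x x))
     in S (\<lambda>w. S (F2 w) - F2 w w))"
proof -
  have one: "(\<Sum>v\<in>V - {i}. U (c v)) = S U - U (c i)" if "i \<in> V" for U i
    using V that by (auto simp: sum_diff S)
  have two: "(\<Sum>v\<in>V - {i, j}. U (c v)) = S U - U (c i) - U (c j)" if "i \<in> V" "j \<in> V - {i}" for U i j
    using V that by (auto simp: sum_diff S)
  have three: "(\<Sum>v\<in>V - {i, j, k}. U (c v)) = S U - U (c i) - U (c j) - U (c k)"
    if "i \<in> V" "j \<in> V - {i}" "k \<in> V - {i, j}" for U i j k
    using V that by (auto simp: sum_diff S)
  define F3 where "F3 = (\<lambda>w x y. S (T w x y) - T w x y w - T w x y x - T w x y y)"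
  define F2 where "F2 = (\<lambda>w x. (S (F3 w x) - F3 w x w - F3 w x x) / 2 + (S (R w x) - R w x w - R w x x))"
  have "(\<Sum>k\<in>V - {i, j}. \<Sum>l\<in>V - {i, j, k}. T (c i) (c j) (c k) (c l)) / 2
      + (\<Sum>k\<in>V - {i, j}. R (c i) (c j) (c k)) = F2 (c i) (c j)" if ij: "i \<in> V" "j \<in> V - {i}" for i j
  proof -
    have "(\<Sum>k\<in>V - {i, j}. \<Sum>l\<in>V - {i, j, k}. T (c i) (c j) (c k) (c l)) =
        (\<Sum>k\<in>V - {i, j}. F3 (c i) (c j) (c k))"
      unfolding F3_def by (rule sum.cong[OF refl], rule three[OF ij])
    then show ?thesis
      unfolding F2_def by (simp only: two[OF ij])
  qed
  then have "(\<Sum>i\<in>V. \<Sum>j\<in>V - {i}. (\<Sum>k\<in>V - {i, j}. \<Sum>l\<in>V - {i, j, k}. T (c i) (c j) (c k) (c l)) / 2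
            + (\<Sum>k\<in>V - {i, j}. R (c i) (c j) (c k))) = (\<Sum>i\<in>V. \<Sum>j\<in>V - {i}. F2 (c i) (c j))"
    by (intro sum.cong refl)
  also have "\<dots> = (\<Sum>i\<in>V. S (F2 (c i)) - F2 (c i) (c i))"
    by (intro sum.cong refl one)
  also have "\<dots> = S (\<lambda>w. S (F2 w) - F2 w w)"
    by (rule S)
  finally show ?thesis
    unfolding Let_def F2_def F3_def .
qed

lemma expected_num_edges_random_graph:
  fixes d :: nat
  assumes p: "0 \<le> p" "p \<le> 1"
  defines "x \<equiv> real d"
  shows "expected_num_edges (random_graph d p) =
    x * (x - 1) * (x - 2) / 2 * p\<^sup>2 + x * (x - 1) * (x - 2) * (x - 3) / 8 * (p\<^sup>2 * (1 - p\<^sup>2)\<^sup>2)"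
proof -
  define r where "r = p * p"
  define t where "t = r * (1 - r) * (1 - r)"
  have "expected_num_edges (random_graph d p) =
    (\<Sum>i\<in>{1..d}. \<Sum>j\<in>{1..d} - {i}.
       (\<Sum>k\<in>{1..d} - {i, j}. \<Sum>l\<in>{1..d} - {i, j, k}. t) / 2 + (\<Sum>k\<in>{1..d} - {i, j}. r + r)) / 4"
    unfolding expected_num_edges_independent[OF independent_edges_random_graph[OF p]] t_def r_def ..
  also have "\<dots> = x * (x - 1) * (x - 2) / 2 * r + x * (x - 1) * (x - 2) * (x - 3) / 8 * t"
    \<comment> \<open>All vertices have the one colour \<open>()\<close>, so the unrestricted sum is
      \<open>x * U ()\<close>.\<close>
    by (subst sum_distinct_coloured[of "{1..d}" "\<lambda>_. ()" "\<lambda>U. x * U ()" "\<lambda>_ _ _ _. t" "\<lambda>_ _ _. r + r"])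
       (simp_all add: x_def Let_def algebra_simps add_divide_distrib diff_divide_distrib)
  finally show ?thesis
    by (simp add: t_def r_def power2_eq_square mult.assoc)
qed

text \<open>Vertices are coloured by their part. The first three terms count adjacent edges: triples
  inside a part, then triples split 2:1 with middle vertex on the larger or the smaller side. Then
  come disjoint edges on quadruples split 3:1 and 2:2. A quadruple inside one part gives nothing, as
  all its pairs are edges; in a 2:2 split only the two edges inside opposite parts count, since two
  crossing edges are always obstructed by those.\<close>

lemma expected_num_edges_complement_random_bipartite:
  fixes d :: nat
  assumes p: "0 \<le> p" "p \<le> 1" and bip: "balanced_bipartition d V1 V2"
  defines "n \<equiv> real d / 2" and "q \<equiv> 1 - p"
  shows "expected_num_edges (complement_random_bipartite d V1 V2 p) =
    n * (n - 1) * (n - 2) + 2 * n\<^sup>2 * (n - 1) * q + n\<^sup>2 * (n - 1) * q\<^sup>2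
      + n\<^sup>2 * (n - 1) * (n - 2) * (q * (1 - q)\<^sup>2) + n\<^sup>2 * (n - 1)\<^sup>2 / 4 * (1 - q\<^sup>2)\<^sup>2"
proof -
  define h where "h = (\<lambda>a b :: bool. if a = b then 1 else q)"
  define c where "c = (\<lambda>v. v \<in> V1)"
  have V: "V1 \<union> V2 = {1..d}" "V1 \<inter> V2 = {}" "card V1 = d div 2" "card V2 = d div 2" "even d"
    using bip by (auto simp: balanced_bipartition_def)
  have fin: "finite V1" "finite V2" using V(1) by (metis finite_Un finite_atLeastAtMost)+
  have S: "(\<Sum>v\<in>{1..d}. U (c v)) = n * (U True + U False)" for U :: "bool \<Rightarrow> real"
  proof -
    have "(\<Sum>v\<in>{1..d}. U (c v)) = (\<Sum>v\<in>V1. U (c v)) + (\<Sum>v\<in>V2. U (c v))"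
      unfolding V(1)[symmetric] using fin V by (intro sum.union_disjoint) auto
    also have "(\<Sum>v\<in>V1. U (c v)) = (\<Sum>v\<in>V1. U True)"
      by (intro sum.cong) (auto simp: c_def)
    also have "(\<Sum>v\<in>V2. U (c v)) = (\<Sum>v\<in>V2. U False)"
      using V(2) by (intro sum.cong) (auto simp: c_def intro!: arg_cong[where f = U])
    finally show ?thesis
      using V by (simp add: n_def real_of_nat_div algebra_simps)
  qed
  have pr: "(if {i, j} \<in> complete_bipartite V1 V2 then 1 - p else 1) = h (c i) (c j)"
    if "i \<in> {1..d}" "j \<in> {1..d}" for i j
  proof -
    have "{i, j} \<in> complete_bipartite V1 V2 \<longleftrightarrow> c i \<noteq> c j"
      using that V(2) unfolding V(1)[symmetric] c_def complete_bipartite_def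
      by (auto simp: doubleton_eq_iff)
    then show ?thesis by (simp add: h_def q_def)
  qed
  have "expected_num_edges (complement_random_bipartite d V1 V2 p) =
    (\<Sum>i\<in>{1..d}. \<Sum>j\<in>{1..d} - {i}.
       (\<Sum>k\<in>{1..d} - {i, j}. \<Sum>l\<in>{1..d} - {i, j, k}.
          h (c i) (c j) * h (c k) (c l) * (1 - h (c i) (c k) * h (c j) (c l)) * (1 - h (c i) (c l) * h (c j) (c k))) / 2
       + (\<Sum>k\<in>{1..d} - {i, j}. h (c i) (c j) * h (c i) (c k) + h (c i) (c j) * h (c j) (c k))) / 4"
    unfolding expected_num_edges_independent[OF independent_edges_complement_random_bipartite[OF p V(1)]]
    by (intro arg_cong2[where f = "(/)"] arg_cong2[where f = "(+)"] arg_cong2[where f = "(-)"]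
          arg_cong2[where f = "(*)"] sum.cong refl; rule pr; auto)
  also have "\<dots> = n * (n - 1) * (n - 2) + 2 * n\<^sup>2 * (n - 1) * q + n\<^sup>2 * (n - 1) * q\<^sup>2
      + n\<^sup>2 * (n - 1) * (n - 2) * (q * (1 - q)\<^sup>2) + n\<^sup>2 * (n - 1)\<^sup>2 / 4 * (1 - q\<^sup>2)\<^sup>2"
    unfolding sum_distinct_coloured[of "{1..d}" c "\<lambda>U. n * (U True + U False)"
        "\<lambda>w x y z. h w x * h y z * (1 - h w y * h x z) * (1 - h w z * h x y)"
        "\<lambda>w x y. h w x * h w y + h w x * h x y", OF finite_atLeastAtMost S] Let_def
    by (simp add: h_def) (simp add: field_simps power2_eq_square)
  finally show ?thesis .
qed

section \<open>Asymptotics and comparison of the two models\<close>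

lemma cubic_bigo:
  "(\<lambda>d::nat. a * real d ^ 3 + b * real d ^ 2 + c * real d) \<in> O(\<lambda>d. real d ^ 3)"
proof -
  have "(\<lambda>d::nat. real d ^ 2) \<in> O(\<lambda>d. real d ^ 3)" "(\<lambda>d::nat. real d) \<in> O(\<lambda>d. real d ^ 3)"
    by real_asymp+
  then show ?thesis
    by (intro sum_in_bigo) auto
qed

lemma quartic_eventually_pos:
  fixes a b c e :: real
  assumes "a > 0"
  shows "eventually (\<lambda>d::nat. a * real d ^ 4 + b * real d ^ 3 + c * real d ^ 2 + e * real d > 0) at_top"
  using assms by real_asymp

text \<open>The lower bound has little room: \<open>(5 * s - 11) / 8 > 1 / 54\<close> needs
  \<open>s\<close> above about 2.2296. Both bounds together put \<open>3 - s\<close> between 0 and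
  1.\<close>

lemma sqrt5_bounds: "2.23 < sqrt 5" "sqrt 5 < 2.25"
  by (rule real_less_rsqrt, simp add: power2_eq_square) (rule real_less_lsqrt, simp_all add: power2_eq_square)

theorem theorem2p2:
  shows "(\<exists>P :: real poly. degree P = 4 \<and>
            (\<forall>d V1 V2. balanced_bipartition d V1 V2 \<longrightarrow>
               expected_num_edges (complement_random_bipartite d V1 V2 (3 - sqrt 5)) = poly P (real d)) \<and>
            (\<lambda>d::nat. poly P (real d) - (5 * sqrt 5 - 11) / 8 * real d ^ 4) \<in> O(\<lambda>d. real d ^ 3)) \<and>
         (\<exists>d0::nat. \<forall>d\<ge>d0. \<forall>V1 V2. balanced_bipartition d V1 V2 \<longrightarrow>
            expected_num_edges (complement_random_bipartite d V1 V2 (3 - sqrt 5))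
              > expected_num_edges (random_graph d (1 / sqrt 3)))"
proof -
  define s :: real where "s = sqrt 5"
  have s2: "s * s = 5" by (simp add: s_def)
  have s_bounds: "2.23 < s" "s < 2.25" using sqrt5_bounds by (simp_all add: s_def)
  \<comment> \<open>The coefficients come from putting \<open>n = x / 2\<close> and
    \<open>q = s - 2\<close> into the exact formula and reducing with
    \<open>s * s = 5\<close>.\<close>
  define P where "P = [:0, 1, (19 * s - 44) / 2, (27 - 12 * s) / 2, (5 * s - 11) / 8:]"
  have poly_P: "poly P x = (5 * s - 11) / 8 * x ^ 4 + (27 - 12 * s) / 2 * x ^ 3 + (19 * s - 44) / 2 * x ^ 2 + x"
    for x by (simp add: P_def algebra_simps power2_eq_square power3_eq_cube power4_eq_xxxx)
  have E: "expected_num_edges (complement_random_bipartite d V1 V2 (3 - sqrt 5)) = poly P (real d)"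
    if "balanced_bipartition d V1 V2" for d V1 V2
  proof -
    define n where "n = real d / 2"
    \<comment> \<open>This \<open>q\<close> is the root of \<open>1 - 4 * q - q\<^sup>2\<close>
      between 0 and 1, where the derivative of the leading coefficient
      \<open>q * (1 - q)\<^sup>2 + (1 - q\<^sup>2)\<^sup>2 / 4\<close> vanishes.\<close>
    have q: "1 - (3 - s) = s - 2" by simp
    have q2: "(s - 2)\<^sup>2 = 9 - 4 * s" "(s - 2) * (1 - (s - 2))\<^sup>2 = 26 * s - 58"
        "(1 - (9 - 4 * s))\<^sup>2 = 16 * (9 - 4 * s)"
      using s2 by (simp_all add: power2_eq_square algebra_simps)
    have "expected_num_edges (complement_random_bipartite d V1 V2 (3 - s)) =
        n * (n - 1) * (n - 2) + 2 * n\<^sup>2 * (n - 1) * (s - 2) + n\<^sup>2 * (n - 1) * (9 - 4 * s)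
        + n\<^sup>2 * (n - 1) * (n - 2) * (26 * s - 58) + n\<^sup>2 * (n - 1)\<^sup>2 / 4 * (16 * (9 - 4 * s))"
      using expected_num_edges_complement_random_bipartite[OF _ _ that, of "3 - s"] s_bounds
      unfolding q q2 n_def[symmetric] by simp
    also have "\<dots> = poly P (2 * n)"
      unfolding poly_P by (simp add: field_simps power2_eq_square power3_eq_cube power4_eq_xxxx)
    finally show ?thesis by (simp add: n_def s_def)
  qed
  have R: "expected_num_edges (random_graph d (1 / sqrt 3)) =
      1 / 54 * real d ^ 4 + 1 / 18 * real d ^ 3 - 8 / 27 * real d ^ 2 + 2 / 9 * real d" for d
  proof -
    have "(1 / sqrt 3)\<^sup>2 = (1 / 3 :: real)" by (simp add: power_divide)
    moreover have "1 / sqrt 3 \<le> (1::real)" by simp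
    ultimately show ?thesis
      by (simp add: expected_num_edges_random_graph)
         (simp add: field_simps power2_eq_square power3_eq_cube power4_eq_xxxx)
  qed
  have "degree P = 4" using s_bounds by (simp add: P_def)
  moreover have "(\<lambda>d::nat. poly P (real d) - (5 * sqrt 5 - 11) / 8 * real d ^ 4) \<in> O(\<lambda>d. real d ^ 3)"
    using cubic_bigo[of "(27 - 12 * s) / 2" "(19 * s - 44) / 2" 1] by (simp add: poly_P s_def add.assoc)
  ultimately have first: "\<exists>P :: real poly. degree P = 4 \<and>
      (\<forall>d V1 V2. balanced_bipartition d V1 V2 \<longrightarrow>
         expected_num_edges (complement_random_bipartite d V1 V2 (3 - sqrt 5)) = poly P (real d)) \<and>
      (\<lambda>d::nat. poly P (real d) - (5 * sqrt 5 - 11) / 8 * real d ^ 4) \<in> O(\<lambda>d. real d ^ 3)"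
    using E by (intro exI[of _ P]) simp
  \<comment> \<open>These are the coefficients of \<open>P\<close> minus those in \<open>R\<close>;
    the bound 2.23 makes the leading one positive.\<close>
  have "eventually (\<lambda>d::nat. ((5 * s - 11) / 8 - 1 / 54) * real d ^ 4
      + ((27 - 12 * s) / 2 - 1 / 18) * real d ^ 3 + ((19 * s - 44) / 2 + 8 / 27) * real d ^ 2
      + (1 - 2 / 9) * real d > 0) at_top"
    by (rule quartic_eventually_pos) (use s_bounds in simp)
  then have "eventually (\<lambda>d::nat. poly P (real d) > expected_num_edges (random_graph d (1 / sqrt 3))) at_top"
    by eventually_elim (simp add: poly_P R algebra_simps)
  then obtain d0 where "\<forall>d\<ge>d0. poly P (real d) > expected_num_edges (random_graph d (1 / sqrt 3))"
    unfolding eventually_at_top_linorder by blast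
  then have "\<forall>d\<ge>d0. \<forall>V1 V2. balanced_bipartition d V1 V2 \<longrightarrow>
      expected_num_edges (complement_random_bipartite d V1 V2 (3 - sqrt 5))
        > expected_num_edges (random_graph d (1 / sqrt 3))"
    by (simp add: E)
  with first show ?thesis by blast
qed

end
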